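(* Let $H$ be a Hilbert space and let $A : D(A) \subset H \to H$ be the infinitesimal generator of a $C_0$-group $(T(t))_{t \in \mathbb{R}}$ on $H$. Denote the eigenvalues of $A$ by $\lambda_n$, $n \in \mathbb{N}$ (counted with multiplicity), and the corresponding normalized eigenvectors by $\phi_n$, $n\in\mathbb{N}$. Suppose that the following two conditions hold: 1. the span of the eigenvectors $\{\phi_n\}_{n\in\mathbb{N}}$ is dense in $H$; 2. the point spectrum has a uniform gap, i.e., $\inf_{n \neq m} |\lambda_n - \lambda_m| > 0$. Then the eigenvectors $\{\phi_n\}_{n \in \mathbb{N}}$ form a Riesz basis of $H$.
   Context: A $C_0$-group on $H$ is a strongly continuous one-parameter group of bounded operators $(T(t))_{t\in\mathbb{R}}$; its infinitesimal generator is the (in general unbounded) operator $A$ given by $Ax=\lim_{t\to 0} t^{-1}(T(t)x-x)$ on the domain $D(A)$ of those $x$ for which the limit exists. A sequence $\{\phi_n\}_{n\in\mathbb{N}}$ in $H$ is a Riesz basis of $H$ if its (finite linear) span is dense in $H$ and there exist positive constants $m$ and $M$ such that for every $N \in \mathbb{N}$ and every finite sequence of scalars $\{\alpha_n\}_{n=1}^N$, $$ m \sum_{n=1}^N |\alpha_n|^2 \leq \Big\|\sum_{n=1}^N \alpha_n \phi_n \Big\|^2 \leq M \sum_{n=1}^N |\alpha_n|^2 .$$ Since the eigenvalues are counted with multiplicity, condition 2 entails that all eigenvalues are simple. *)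

theory Defs
  imports "HOL-Analysis.Analysis"
begin

section \<open>Complex Hilbert spaces\<close>

class scaleC = scaleR +
  fixes scaleC :: "complex \<Rightarrow> 'a \<Rightarrow> 'a"  (infixr \<open>*\<^sub>C\<close> 75)
  assumes scaleR_scaleC: "scaleR r x = scaleC (complex_of_real r) x"

class complex_vector = scaleC + ab_group_add +
  assumes scaleC_add_right: "a *\<^sub>C (x + y) = a *\<^sub>C x + a *\<^sub>C y"
    and scaleC_add_left: "(a + b) *\<^sub>C x = a *\<^sub>C x + b *\<^sub>C x"
    and scaleC_scaleC: "a *\<^sub>C (b *\<^sub>C x) = (a * b) *\<^sub>C x"
    and scaleC_one: "1 *\<^sub>C x = x"

text \<open>
  The complex inner product is conjugate-linear in its first argument. Its real part is required
  to be the inner product of the underlying real inner product space, so that positive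
  definiteness, the norm \<open>norm x = sqrt (Re (cinner x x))\<close> and the topology are inherited from
  \<^class>\<open>real_inner\<close>. This is no restriction: the real part of a complex inner product is always
  a real inner product with the same norm.
\<close>

class complex_inner = complex_vector + real_inner +
  fixes cinner :: "'a \<Rightarrow> 'a \<Rightarrow> complex"
  assumes cinner_commute: "cinner x y = cnj (cinner y x)"
    and cinner_add_left: "cinner (x + y) z = cinner x z + cinner y z"
    and cinner_scaleC_left: "cinner (a *\<^sub>C x) y = cnj a * cinner x y"
    and inner_eq_Re_cinner: "inner x y = Re (cinner x y)"

class chilbert_space = complex_inner + complete_space
begin
subclass banach ..
end

global_interpretation complex_vector:
  vector_space "scaleC :: complex \<Rightarrow> 'a \<Rightarrow> 'a::complex_vector"
  by unfold_locales (rule scaleC_add_right scaleC_add_left scaleC_scaleC scaleC_one)+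

instantiation complex :: chilbert_space
begin
definition scaleC_complex :: "complex \<Rightarrow> complex \<Rightarrow> complex" where "scaleC_complex a x = a * x"
definition cinner_complex :: "complex \<Rightarrow> complex \<Rightarrow> complex" where "cinner_complex x y = cnj x * y"
instance
  by standard
    (auto simp: scaleC_complex_def cinner_complex_def inner_complex_def scaleR_conv_of_real
      algebra_simps)
end

lemma norm_eq_sqrt_cinner: "norm (x :: 'a::complex_inner) = sqrt (Re (cinner x x))"
  by (simp add: norm_eq_sqrt_inner inner_eq_Re_cinner)

definition bounded_clinear :: "('a::complex_inner \<Rightarrow> 'b::complex_inner) \<Rightarrow> bool" where
  "bounded_clinear f \<longleftrightarrow> bounded_linear f \<and> (\<forall>c x. f (c *\<^sub>C x) = c *\<^sub>C f x)"


section \<open>Groups of operators and their generators\<close>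

definition C0_group :: "(real \<Rightarrow> 'a \<Rightarrow> 'a::chilbert_space) \<Rightarrow> bool" where
  "C0_group T \<longleftrightarrow>
     (\<forall>t. bounded_clinear (T t)) \<and>
     (\<forall>x. T 0 x = x) \<and>
     (\<forall>s t x. T (s + t) x = T s (T t x)) \<and>
     (\<forall>x. continuous_on UNIV (\<lambda>t. T t x))"

text \<open>
  An unbounded operator is given by its domain \<open>D\<close> and a function \<open>A\<close> whose values outside \<open>D\<close>
  are irrelevant.
\<close>

definition is_generator ::
    "(real \<Rightarrow> 'a \<Rightarrow> 'a::chilbert_space) \<Rightarrow> 'a set \<Rightarrow> ('a \<Rightarrow> 'a) \<Rightarrow> bool" where
  "is_generator T D A \<longleftrightarrow>
     D = {x. \<exists>y. ((\<lambda>t. (1 / t) *\<^sub>R (T t x - x)) \<longlongrightarrow> y) (at 0)} \<and>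
     (\<forall>x\<in>D. ((\<lambda>t. (1 / t) *\<^sub>R (T t x - x)) \<longlongrightarrow> A x) (at 0))"


section \<open>Eigenvalues and Riesz bases\<close>

definition eigenspace :: "'a set \<Rightarrow> ('a \<Rightarrow> 'a) \<Rightarrow> complex \<Rightarrow> 'a::chilbert_space set" where
  "eigenspace D A \<mu> = {x \<in> D. A x = \<mu> *\<^sub>C x}"

definition is_eigenvalue :: "'a set \<Rightarrow> ('a \<Rightarrow> 'a::chilbert_space) \<Rightarrow> complex \<Rightarrow> bool" where
  "is_eigenvalue D A \<mu> \<longleftrightarrow> (\<exists>x \<in> eigenspace D A \<mu>. x \<noteq> 0)"

text \<open>
  \<open>lam\<close> lists all eigenvalues, each repeated according to its (geometric) multiplicity, and
  \<open>\<phi>\<close> the corresponding normalized eigenvectors: the vectors \<open>\<phi> n\<close> whose index satisfies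
  \<open>lam n = \<mu>\<close> are pairwise distinct and form a basis of the eigenspace of \<open>\<mu>\<close>.
\<close>

definition eigen_enumeration ::
    "'a set \<Rightarrow> ('a \<Rightarrow> 'a) \<Rightarrow> (nat \<Rightarrow> complex) \<Rightarrow> (nat \<Rightarrow> 'a::chilbert_space) \<Rightarrow> bool" where
  "eigen_enumeration D A lam \<phi> \<longleftrightarrow>
     range lam = {\<mu>. is_eigenvalue D A \<mu>} \<and>
     (\<forall>n. \<phi> n \<in> eigenspace D A (lam n) \<and> norm (\<phi> n) = 1) \<and>
     (\<forall>\<mu>. inj_on \<phi> {n. lam n = \<mu>} \<and>
          complex_vector.independent (\<phi> ` {n. lam n = \<mu>}) \<and>
          complex_vector.span (\<phi> ` {n. lam n = \<mu>}) = eigenspace D A \<mu>)"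

definition riesz_basis :: "(nat \<Rightarrow> 'a::chilbert_space) \<Rightarrow> bool" where
  "riesz_basis \<phi> \<longleftrightarrow>
     closure (complex_vector.span (range \<phi>)) = UNIV \<and>
     (\<exists>m>0. \<exists>M>0. \<forall>(N::nat) (\<alpha> :: nat \<Rightarrow> complex).
        m * (\<Sum>n<N. (cmod (\<alpha> n))\<^sup>2) \<le> (norm (\<Sum>n<N. \<alpha> n *\<^sub>C \<phi> n))\<^sup>2 \<and>
        (norm (\<Sum>n<N. \<alpha> n *\<^sub>C \<phi> n))\<^sup>2 \<le> M * (\<Sum>n<N. (cmod (\<alpha> n))\<^sup>2))"

end

theory Submission
  imports Defs "HOL-Probability.Probability"
begin

text \<open>
  Since \<open>T t (\<phi> n) = exp (lam n * t) \<phi> n\<close>, a finite combination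
  \<open>x = (\<Sum>n. \<alpha> n \<phi> n)\<close> has the orbit \<open>T t x = (\<Sum>n. \<alpha> n exp (lam n * t) \<phi> n)\<close>. The proof
  evaluates the mean of \<open>(norm (T (c * s) x))\<^sup>2\<close> over a standard normal variable \<open>s\<close> in two ways,
  for a suitable time scale \<open>c > 0\<close>.

  On the one hand the mean is comparable to \<open>(norm x)\<^sup>2\<close>, because a group and its inverse grow
  at most exponentially and exponentials are integrable against a Gaussian
  (\<open>C0_group_gaussian_mean_equivalent\<close>).

  On the other hand, expanding the square gives a quadratic form in \<open>\<alpha>\<close> whose entries are
  Gaussian moments, known in closed form. With \<open>b n = cmod (\<alpha> n) exp ((c Re (lam n))\<^sup>2)\<close>, the diagonal
  terms are \<open>(b n)\<^sup>2\<close>, and the \<open>(n, m)\<close> term is at most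
  \<open>b n * b m * exp (- (c * cmod (lam n - lam m))\<^sup>2 / 2)\<close>
  (\<open>gaussian_gram_entry\<close>): the Gaussian weight turns the distance of eigenvalues in the complex
  plane, and not merely that of their imaginary parts, into decay. As the eigenvalues are
  uniformly separated, the factors \<open>exp (- (c * cmod (lam n - lam m))\<^sup>2 / 2)\<close> with \<open>m \<noteq> n\<close> sum to
  at most \<open>1 / 2\<close> for each \<open>n\<close> once \<open>c\<close> is large (\<open>separated_gaussian_sum_small\<close>), so by the
  Schur test the mean lies between one half and three halves of \<open>\<Sum>n. (b n)\<^sup>2\<close>
  (\<open>gaussian_mean_square_bounds\<close>). Finally, the eigenvalues lie in a vertical strip, so that \<open>b n\<close> is comparable to \<open>cmod (\<alpha> n)\<close> uniformly in
  \<open>n\<close>, and the two evaluations together are the Riesz basis inequalities.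
\<close>

section \<open>Complex inner product spaces\<close>

lemma cinner_add_right:
  fixes x y z :: "'a::complex_inner"
  shows "cinner x (y + z) = cinner x y + cinner x z"
  by (metis cinner_add_left cinner_commute complex_cnj_add)

lemma cinner_scaleC_right:
  fixes x y :: "'a::complex_inner"
  shows "cinner x (a *\<^sub>C y) = a * cinner x y"
  by (metis cinner_scaleC_left cinner_commute complex_cnj_mult complex_cnj_cnj)

lemma cinner_sum_left:
  fixes f :: "'i \<Rightarrow> 'a::complex_inner"
  shows "cinner (\<Sum>i\<in>F. f i) y = (\<Sum>i\<in>F. cinner (f i) y)"
proof (induction F rule: infinite_finite_induct)
  have "cinner (0::'a) y = 0"
    using cinner_add_left[of "0::'a" 0 y] by simp
  then show "cinner (\<Sum>i\<in>{}. f i) y = (\<Sum>i\<in>{}. cinner (f i) y)"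
    and "infinite F \<Longrightarrow> cinner (\<Sum>i\<in>F. f i) y = (\<Sum>i\<in>F. cinner (f i) y)" for F
    by auto
qed (simp add: cinner_add_left)

lemma cinner_sum_right:
  fixes f :: "'i \<Rightarrow> 'a::complex_inner"
  shows "cinner y (\<Sum>i\<in>F. f i) = (\<Sum>i\<in>F. cinner y (f i))"
  by (subst (1 2) cinner_commute) (simp add: cinner_sum_left)

lemma cinner_self:
  fixes x :: "'a::complex_inner"
  shows "cinner x x = of_real ((norm x)\<^sup>2)"
proof -
  have "Im (cinner x x) = 0"
    using arg_cong[OF cinner_commute[of x x], of Im] by simp
  moreover have "Re (cinner x x) = (norm x)\<^sup>2"
    by (simp add: inner_eq_Re_cinner[symmetric] dot_square_norm)
  ultimately show ?thesis
    by (simp add: complex_eq_iff)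
qed

lemma norm_scaleC:
  fixes x :: "'a::complex_inner"
  shows "norm (a *\<^sub>C x) = cmod a * norm x"
proof -
  have "complex_of_real ((norm (a *\<^sub>C x))\<^sup>2) = cnj a * a * of_real ((norm x)\<^sup>2)"
    by (simp only: cinner_self[symmetric] cinner_scaleC_left cinner_scaleC_right mult_ac)
  also have "\<dots> = of_real ((cmod a * norm x)\<^sup>2)"
    by (simp only: power_mult_distrib of_real_mult complex_norm_square mult_ac)
  finally have "(norm (a *\<^sub>C x))\<^sup>2 = (cmod a * norm x)\<^sup>2"
    by (simp only: of_real_eq_iff)
  then show ?thesis
    by (rule power2_eq_imp_eq) auto
qed

text \<open>Rotating \<open>x\<close> by a phase makes the inner product real, so the bound is the real one.\<close>

lemma cmod_cinner_le:
  fixes x y :: "'a::complex_inner"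
  shows "cmod (cinner x y) \<le> norm x * norm y"
proof (cases "cinner x y = 0")
  case False
  define u where "u = sgn (cinner x y)"
  have u: "cmod u = 1"
    using False by (simp add: u_def norm_sgn)
  have "cnj u * cinner x y = of_real (cmod (cinner x y))"
    using False by (simp add: u_def sgn_eq field_simps complex_norm_square[symmetric] power2_eq_square)
  then have "cmod (cinner x y) = inner (u *\<^sub>C x) y"
    by (simp add: inner_eq_Re_cinner cinner_scaleC_left)
  also have "\<dots> \<le> norm (u *\<^sub>C x) * norm y"
    by (rule norm_cauchy_schwarz)
  finally show ?thesis
    by (simp add: norm_scaleC u)
qed simp

lemma bounded_bilinear_scaleC:
  "bounded_bilinear (scaleC :: complex \<Rightarrow> 'a::complex_inner \<Rightarrow> 'a)"
proof
  show "\<exists>K. \<forall>a (x::'a). norm (a *\<^sub>C x) \<le> norm a * norm x * K"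
    by (rule exI[of _ 1]) (simp add: norm_scaleC)
qed (simp_all add: scaleC_add_left scaleC_add_right scaleR_scaleC[where 'a='a] scaleC_scaleC mult.commute scaleR_conv_of_real)

section \<open>Growth of a strongly continuous group\<close>

text \<open>
  The Banach--Steinhaus theorem: by the Baire category theorem one of the closed sets on which all
  \<open>f i\<close> are bounded by a fixed \<open>n\<close> contains a ball, and linearity moves that ball to the origin.
\<close>

lemma uniform_boundedness:
  fixes f :: "'i \<Rightarrow> 'a::banach \<Rightarrow> 'b::real_normed_vector"
  assumes lin: "\<And>i. i \<in> I \<Longrightarrow> bounded_linear (f i)"
    and bdd: "\<And>x. \<exists>B. \<forall>i\<in>I. norm (f i x) \<le> B"
  shows "\<exists>K. \<forall>i\<in>I. \<forall>x. norm (f i x) \<le> K * norm x"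
proof -
  define S where "S n = {x. \<forall>i\<in>I. norm (f i x) \<le> real n}" for n
  have S_eq: "S n = (\<Inter>i\<in>I. {x. norm (f i x) \<le> real n})" for n
    by (auto simp: S_def)
  have closed: "closed (S n)" for n
    unfolding S_eq
    by (intro closed_INT ballI closed_Collect_le continuous_on_const continuous_on_norm
        linear_continuous_on lin)
  have "(\<Union>n. S n) = UNIV"
  proof (intro equalityI subsetI UNIV_I)
    fix x
    obtain B where "\<forall>i\<in>I. norm (f i x) \<le> B" using bdd by blast
    then have "x \<in> S (nat \<lceil>B\<rceil>)"
      unfolding S_def by (auto intro: order_trans real_nat_ceiling_ge)
    then show "x \<in> (\<Union>n. S n)" by blast
  qed
  moreover have "interior (\<Union>n. S n) = {}" if "\<And>n. interior (S n) = {}"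
    using Baire_category_alt[of "euclidean :: 'a topology" "range S"]
      that closed completely_metrizable_space_euclidean by auto
  ultimately have "\<exists>n. interior (S n) \<noteq> {}"
    by fastforce
  then obtain n a where "a \<in> interior (S n)" by blast
  then obtain r where r: "r > 0" "cball a r \<subseteq> S n"
    unfolding mem_interior_cball by blast
  show ?thesis
  proof (intro exI ballI allI)
    fix i x assume i: "i \<in> I"
    interpret bounded_linear "f i" by (rule lin[OF i])
    show "norm (f i x) \<le> (2 * real n / r) * norm x"
    proof (cases "x = 0")
      case False
      define y where "y = (r / norm x) *\<^sub>R x"
      have "norm y = r" using False r by (simp add: y_def)
      then have "a + y \<in> S n" "a \<in> S n" using r by (auto simp: dist_norm)
      then have "norm (f i (a + y)) \<le> real n" "norm (f i a) \<le> real n"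
        using i by (auto simp: S_def)
      moreover have "norm (f i y) \<le> norm (f i (a + y)) + norm (f i a)"
        using norm_triangle_ineq4[of "f i (a + y)" "f i a"] diff[of "a + y" a] by simp
      ultimately have "norm (f i y) \<le> 2 * real n"
        by linarith
      moreover have "norm (f i y) = (r / norm x) * norm (f i x)"
        using r by (simp add: y_def scaleR)
      ultimately show ?thesis using False r by (simp add: field_simps)
    qed (simp add: zero)
  qed
qed

text \<open>
  Uniform boundedness gives one bound \<open>K\<close> for all \<open>T t\<close> with \<open>\<bar>t\<bar> \<le> 1\<close>; a general \<open>T t\<close> is a product
  of at most \<open>\<bar>t\<bar> + 1\<close> operators of this kind.
\<close>

lemma C0_group_growth:
  assumes "C0_group T"
  obtains K w where "K \<ge> 1" "w \<ge> 0" "\<And>t x. norm (T t x) \<le> K * exp (w * \<bar>t\<bar>) * norm x"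
proof -
  have lin: "bounded_linear (T t)" and T0: "T 0 x = x" and Tadd: "T (s + t) x = T s (T t x)"
    and cont: "continuous_on UNIV (\<lambda>t. T t x)" for s t x
    using assms by (auto simp: C0_group_def bounded_clinear_def)
  have "\<exists>B. \<forall>t\<in>{-1..1}. norm (T t x) \<le> B" for x
  proof -
    have "compact ((\<lambda>t. T t x) ` {-1..1})"
      by (intro compact_continuous_image continuous_on_subset[OF cont]) auto
    then show ?thesis
      using compact_imp_bounded bounded_iff by (metis (no_types, lifting) imageI)
  qed
  then obtain L where L: "\<And>t x. t \<in> {-1..1} \<Longrightarrow> norm (T t x) \<le> L * norm x"
    using uniform_boundedness[of "{-1..1}" T] lin by blast
  define K where "K = max 1 L"
  have K1: "K \<ge> 1" by (simp add: K_def)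
  have K: "norm (T t x) \<le> K * norm x" if "\<bar>t\<bar> \<le> 1" for t x
  proof -
    have "L * norm x \<le> K * norm x" by (intro mult_right_mono) (auto simp: K_def)
    then show ?thesis using L[of t x] that by force
  qed
  have pow: "norm (T (real n * s) x) \<le> K ^ n * norm x" if s: "\<bar>s\<bar> \<le> 1" for n s x
  proof (induction n)
    case (Suc n)
    have "T (real (Suc n) * s) x = T s (T (real n * s) x)"
      by (simp add: Tadd[symmetric] algebra_simps)
    also have "norm \<dots> \<le> K * norm (T (real n * s) x)" by (rule K[OF s])
    also have "\<dots> \<le> K * (K ^ n * norm x)" using Suc K1 by (intro mult_left_mono) auto
    finally show ?case by (simp add: mult.assoc)
  qed (simp add: T0)
  have "norm (T t x) \<le> K * exp (ln K * \<bar>t\<bar>) * norm x" for t x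
  proof -
    define n where "n = Suc (nat \<lfloor>\<bar>t\<bar>\<rfloor>)"
    have n: "real n \<le> \<bar>t\<bar> + 1" "\<bar>t\<bar> \<le> real n" "n > 0"
      unfolding n_def by linarith+
    have "norm (T (real n * (t / real n)) x) \<le> K ^ n * norm x"
      using n by (intro pow) (auto simp: field_simps)
    also have "K ^ n = exp (ln K * real n)"
      using K1 by (simp add: mult.commute exp_of_nat_mult)
    also have "\<dots> \<le> exp (ln K * (\<bar>t\<bar> + 1))"
      using n K1 by (simp add: mult_left_mono)
    also have "\<dots> = K * exp (ln K * \<bar>t\<bar>)"
      using K1 by (simp add: algebra_simps exp_add)
    finally show ?thesis
      using n by (simp add: mult_right_mono)
  qed
  then show ?thesis
    using that[of K "ln K"] K1 by simp
qed

text \<open>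
  The curve \<open>exp (- \<mu> t) T t \<phi>\<close> has derivative zero, so it keeps its value at \<open>t = 0\<close>.
\<close>

lemma C0_group_eigenvector:
  assumes T: "C0_group T" and gen: "is_generator T D A" and \<phi>: "\<phi> \<in> eigenspace D A \<mu>"
  shows "T t \<phi> = exp (\<mu> * of_real t) *\<^sub>C \<phi>"
proof -
  have clin: "bounded_linear (T t)" "T t (c *\<^sub>C x) = c *\<^sub>C T t x" and T0: "T 0 x = x"
    and Tadd: "T (s + t) x = T s (T t x)" for s t x c
    using T by (auto simp: C0_group_def bounded_clinear_def)
  have lim: "((\<lambda>h. (1 / h) *\<^sub>R (T h \<phi> - \<phi>)) \<longlongrightarrow> \<mu> *\<^sub>C \<phi>) (at 0)"
    using gen \<phi> unfolding is_generator_def eigenspace_def by (metis (mono_tags, lifting) mem_Collect_eq)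
  have deriv: "((\<lambda>t. T t \<phi>) has_vector_derivative \<mu> *\<^sub>C T t \<phi>) (at t)" for t
  proof -
    have "((\<lambda>h. T t ((1 / h) *\<^sub>R (T h \<phi> - \<phi>))) \<longlongrightarrow> T t (\<mu> *\<^sub>C \<phi>)) (at 0)"
      by (rule bounded_linear.tendsto[OF clin(1) lim])
    moreover have "T t ((1 / h) *\<^sub>R (T h \<phi> - \<phi>)) = (T (t + h) \<phi> - T t \<phi>) /\<^sub>R h" for h
      by (simp add: linear_simps[OF clin(1)] Tadd divide_inverse)
    ultimately have "((\<lambda>h. (T (t + h) \<phi> - T t \<phi>) /\<^sub>R h) \<longlongrightarrow> \<mu> *\<^sub>C T t \<phi>) (at 0)"
      by (simp add: clin(2))
    then have "((\<lambda>h. norm ((T (t + h) \<phi> - T t \<phi>) /\<^sub>R h - \<mu> *\<^sub>C T t \<phi>)) \<longlongrightarrow> 0) (at 0)"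
      by (simp add: LIM_zero_iff tendsto_norm_zero_iff)
    moreover have "norm (T (t + h) \<phi> - T t \<phi> - h *\<^sub>R \<mu> *\<^sub>C T t \<phi>) / norm h
        = norm ((T (t + h) \<phi> - T t \<phi>) /\<^sub>R h - \<mu> *\<^sub>C T t \<phi>)" if "h \<noteq> 0" for h
    proof -
      have "T (t + h) \<phi> - T t \<phi> - h *\<^sub>R \<mu> *\<^sub>C T t \<phi>
          = h *\<^sub>R ((T (t + h) \<phi> - T t \<phi>) /\<^sub>R h - \<mu> *\<^sub>C T t \<phi>)"
        using that by (simp add: scaleR_diff_right)
      then show ?thesis using that by simp
    qed
    ultimately have "((\<lambda>h. norm (T (t + h) \<phi> - T t \<phi> - h *\<^sub>R \<mu> *\<^sub>C T t \<phi>) / norm h) \<longlongrightarrow> 0) (at 0)"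
      by (subst tendsto_cong) (auto simp: eventually_at_filter)
    then show ?thesis
      by (simp add: has_vector_derivative_def has_derivative_at bounded_linear_scaleR_left)
  qed
  interpret scaleC: bounded_bilinear "scaleC :: complex \<Rightarrow> 'a \<Rightarrow> 'a"
    by (rule bounded_bilinear_scaleC)
  define u where "u t = exp (- \<mu> * of_real t) *\<^sub>C T t \<phi>" for t :: real
  have "(u has_vector_derivative 0) (at t)" for t
  proof -
    have "((\<lambda>t::real. exp (- \<mu> * of_real t)) has_vector_derivative (- \<mu> * exp (- \<mu> * of_real t))) (at t)"
      by (rule has_vector_derivative_real_field) (auto intro!: derivative_eq_intros)
    from scaleC.has_vector_derivative[OF this deriv]
    show ?thesis
      by (simp add: u_def[abs_def] scaleC_scaleC mult.commute scaleC_add_left[symmetric])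
  qed
  then have "u t = u 0"
    using has_vector_derivative_zero_constant[of UNIV u] by (metis UNIV_I convex_UNIV)
  then have "exp (- \<mu> * of_real t) *\<^sub>C T t \<phi> = \<phi>"
    by (simp add: u_def T0 scaleC_one)
  then have "exp (\<mu> * of_real t) *\<^sub>C (exp (- \<mu> * of_real t) *\<^sub>C T t \<phi>) = exp (\<mu> * of_real t) *\<^sub>C \<phi>"
    by simp
  then show ?thesis
    by (simp add: scaleC_scaleC exp_add[symmetric] scaleC_one)
qed

section \<open>Gaussian averages\<close>

text \<open>
  For imaginary \<open>z\<close> this is the characteristic function of the normal distribution. The real part
  \<open>a\<close> of \<open>z\<close> is absorbed by completing the square, which amounts to a translation by \<open>a\<close>.
\<close>

lemma has_bochner_integral_std_normal_exp:
  fixes z :: complex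
  shows "has_bochner_integral std_normal_distribution (\<lambda>s. exp (z * of_real s)) (exp (z\<^sup>2 / 2))"
proof -
  define a b where "a = Re z" and "b = Im z"
  have z: "z = of_real a + \<i> * of_real b" by (simp add: a_def b_def complex_eq_iff)
  have char: "has_bochner_integral std_normal_distribution (\<lambda>s. iexp (b * s))
      (of_real (exp (- b\<^sup>2 / 2)))"
  proof -
    have "integrable std_normal_distribution (\<lambda>s. iexp (b * s))"
      using prob_space_normal_density[of 1 0]
      by (intro finite_measure.integrable_const_bound[of _ _ 1]) (auto simp: prob_space_def)
    moreover have "(CLINT s|std_normal_distribution. iexp (b * s)) = of_real (exp (- b\<^sup>2 / 2))"
      using fun_cong[OF char_std_normal_distribution, of b] by (simp add: char_def)
    ultimately show ?thesis by (simp add: has_bochner_integral_iff)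
  qed
  then have "has_bochner_integral lborel (\<lambda>s. std_normal_density s *\<^sub>R iexp (b * s))
      (of_real (exp (- b\<^sup>2 / 2)))"
    by (simp add: has_bochner_integral_iff integrable_density integral_density)
  then have "has_bochner_integral lborel
      (\<lambda>s. std_normal_density (- a + 1 * s) *\<^sub>R iexp (b * (- a + 1 * s))) (of_real (exp (- b\<^sup>2 / 2)))"
    by (subst (asm) lborel_has_bochner_integral_real_affine_iff[of 1 _ _ "- a"]) auto
  then have "has_bochner_integral lborel
      (\<lambda>s. exp (of_real (a\<^sup>2 / 2) + \<i> * of_real (a * b)) *
           (std_normal_density (- a + 1 * s) *\<^sub>R iexp (b * (- a + 1 * s))))
      (exp (of_real (a\<^sup>2 / 2) + \<i> * of_real (a * b)) * of_real (exp (- b\<^sup>2 / 2)))"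
    by (intro has_bochner_integral_mult_right)
  moreover have "exp (of_real (a\<^sup>2 / 2) + \<i> * of_real (a * b)) *
           (std_normal_density (- a + 1 * s) *\<^sub>R iexp (b * (- a + 1 * s)))
      = std_normal_density s *\<^sub>R exp (z * of_real s)" for s
  proof -
    have "of_real (a\<^sup>2 / 2) + \<i> * of_real (a * b) + of_real (- (s - a)\<^sup>2 / 2) + \<i> * of_real (b * (s - a))
        = of_real (- s\<^sup>2 / 2) + z * of_real s"
      by (simp add: z power2_eq_square field_simps)
    then have "exp (of_real (a\<^sup>2 / 2) + \<i> * of_real (a * b)) * (exp (of_real (- (s - a)\<^sup>2 / 2))
        * exp (\<i> * of_real (b * (s - a)))) = exp (of_real (- s\<^sup>2 / 2)) * exp (z * of_real s)"
      by (simp only: exp_add[symmetric] add.assoc)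
    then show ?thesis
      by (simp add: std_normal_density_def scaleR_conv_of_real exp_of_real[symmetric] mult_ac
          del: of_real_power)
  qed
  moreover have "exp (of_real (a\<^sup>2 / 2) + \<i> * of_real (a * b)) * of_real (exp (- b\<^sup>2 / 2)) = exp (z\<^sup>2 / 2)"
    unfolding exp_of_real[symmetric] exp_add[symmetric]
    by (rule arg_cong[of _ _ exp]) (simp add: z power2_eq_square field_simps)
  ultimately show ?thesis
    by (intro has_bochner_integral_density) auto
qed

lemma has_bochner_integral_std_normal_exp_real:
  "has_bochner_integral std_normal_distribution (\<lambda>s. exp (b * s)) (exp (b\<^sup>2 / 2))"
  using has_bochner_integral_Re[OF has_bochner_integral_std_normal_exp[of "of_real b"]]
  by (simp add: exp_of_real Re_exp flip: of_real_mult of_real_power)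


text \<open>
  The exponent is governed by \<open>Re ((cnj z + w)\<^sup>2) = (Re z + Re w)\<^sup>2 - (Im z - Im w)\<^sup>2\<close>. Splitting off
  \<open>2 (Re z)\<^sup>2 + 2 (Re w)\<^sup>2\<close>, the values for \<open>z = w\<close>, leaves exactly \<open>- (cmod (z - w))\<^sup>2\<close>.
\<close>

lemma gaussian_gram_entry:
  fixes z w :: complex and c :: real
  shows "cmod (exp ((c * (cnj z + w))\<^sup>2 / 2))
    = exp ((c * Re z)\<^sup>2) * exp ((c * Re w)\<^sup>2) * exp (- (c * cmod (z - w))\<^sup>2 / 2)"
proof -
  have "Re ((c * (cnj z + w))\<^sup>2 / 2) = (c * Re z)\<^sup>2 + (c * Re w)\<^sup>2 + (- (c * cmod (z - w))\<^sup>2 / 2)"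
    by (simp add: power_mult_distrib cmod_power2 Re_power2 Im_power2)
       (simp add: power2_eq_square algebra_simps)
  then show ?thesis
    by (simp only: norm_exp_eq_Re exp_add)
qed

lemma sum_power_abs_int_le:
  fixes q :: real
  assumes "finite K" "0 < q" "q < 1"
  shows "(\<Sum>k\<in>K. q ^ nat \<bar>k\<bar>) \<le> 2 / (1 - q)"
proof -
  have geo: "sum ((^) q) N \<le> 1 / (1 - q)" if "finite N" for N
    using sum_le_suminf[OF summable_geometric, of q N] that assms by (simp add: suminf_geometric)
  have half: "(\<Sum>k\<in>J. q ^ nat \<bar>k\<bar>) \<le> 1 / (1 - q)" if "finite J" "inj_on (\<lambda>k. nat \<bar>k\<bar>) J" for J
    using geo[of "(\<lambda>k. nat \<bar>k\<bar>) ` J"] that by (simp add: sum.reindex)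
  have "(\<Sum>k\<in>K. q ^ nat \<bar>k\<bar>) = (\<Sum>k\<in>K \<inter> {0..}. q ^ nat \<bar>k\<bar>) + (\<Sum>k\<in>K - {0..}. q ^ nat \<bar>k\<bar>)"
    using sum.Int_Diff[OF assms(1)] .
  also have "\<dots> \<le> 1 / (1 - q) + 1 / (1 - q)"
    using assms(1) by (intro add_mono half) (auto simp: inj_on_def)
  finally show ?thesis by simp
qed

text \<open>
  Replaces a Gaussian by a geometric sequence over the cell of length \<open>s\<close> that contains \<open>x\<close>, using
  \<open>2 \<bar>x\<bar> \<le> x\<^sup>2 + 1\<close>.
\<close>

lemma exp_minus_square_le:
  fixes x s :: real
  assumes "s > 0"
  shows "exp (- x\<^sup>2) \<le> exp (1 + 2 * s) * exp (- 2 * s) ^ nat \<bar>\<lfloor>x / s\<rfloor>\<bar>"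
proof -
  define k where "k = \<lfloor>x / s\<rfloor>"
  have "of_int k \<le> x / s" "x / s < of_int k + 1" by (auto simp: k_def)
  then have "\<bar>real_of_int k\<bar> \<le> \<bar>x / s\<bar> + 1" by linarith
  then have "s * \<bar>real_of_int k\<bar> \<le> \<bar>x\<bar> + s"
    using assms by (simp add: field_simps)
  moreover have "2 * \<bar>x\<bar> \<le> x\<^sup>2 + 1"
    using zero_le_power2[of "\<bar>x\<bar> - 1"] by (simp add: power2_diff)
  ultimately have "- x\<^sup>2 \<le> 1 + 2 * s + real (nat \<bar>k\<bar>) * (- 2 * s)"
    by (simp add: algebra_simps)
  then show ?thesis
    unfolding k_def[symmetric] by (simp only: exp_of_nat_mult[symmetric] exp_add[symmetric] exp_le_cancel_iff)
qed

text \<open>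
  A square of side \<open>\<delta> / 2\<close> has diameter less than \<open>\<delta>\<close> and therefore contains at most one of the
  points, so the sum is dominated by a product of two geometric series over the cells of a square
  grid. The constant depends on \<open>\<delta>\<close> only.
\<close>

lemma separated_gaussian_sum_bounded:
  assumes "\<delta> > 0"
  shows "\<exists>C>0. \<forall>(d::'i \<Rightarrow> complex) F. finite F \<longrightarrow>
    (\<forall>i\<in>F. \<forall>j\<in>F. i \<noteq> j \<longrightarrow> \<delta> \<le> cmod (d i - d j)) \<longrightarrow> (\<Sum>i\<in>F. exp (- (cmod (d i))\<^sup>2)) \<le> C"
proof -
  define s where "s = \<delta> / 2"
  have s: "s > 0" using assms by (simp add: s_def)
  define q where "q = exp (- 2 * s)"
  have q: "0 < q" "q < 1" using s by (auto simp: q_def)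
  define B where "B = exp (1 + 2 * s)"
  define C where "C = (B * (2 / (1 - q)))\<^sup>2"
  have bound: "(\<Sum>i\<in>F. exp (- (cmod (d i))\<^sup>2)) \<le> C"
    if F: "finite F" and sep: "\<forall>i\<in>F. \<forall>j\<in>F. i \<noteq> j \<longrightarrow> \<delta> \<le> cmod (d i - d j)"
    for d :: "'i \<Rightarrow> complex" and F
  proof -
    define g where "g i = (\<lfloor>Re (d i) / s\<rfloor>, \<lfloor>Im (d i) / s\<rfloor>)" for i
    have same: "\<bar>x - y\<bar> < s" if "\<lfloor>x / s\<rfloor> = \<lfloor>y / s\<rfloor>" for x y :: real
    proof -
      have "\<bar>x / s - y / s\<bar> < 1" using that by linarith
      then show ?thesis using s by (simp add: field_simps abs_less_iff)
    qed
    have inj: "inj_on g F"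
    proof (rule inj_onI, rule ccontr)
      fix i j assume ij: "i \<in> F" "j \<in> F" "g i = g j" "i \<noteq> j"
      have "cmod (d i - d j) \<le> \<bar>Re (d i - d j)\<bar> + \<bar>Im (d i - d j)\<bar>" by (rule cmod_le)
      also have "\<dots> < s + s"
        using ij(3) same[of "Re (d i)" "Re (d j)"] same[of "Im (d i)" "Im (d j)"]
        by (intro add_strict_mono) (auto simp: g_def)
      finally show False using sep ij(1,2,4) by (force simp: s_def)
    qed
    define w where "w = (\<lambda>(k::int, l::int). (B * q ^ nat \<bar>k\<bar>) * (B * q ^ nat \<bar>l\<bar>))"
    have w0: "w p \<ge> 0" for p using q by (auto simp: w_def B_def split: prod.split)
    have "(\<Sum>i\<in>F. exp (- (cmod (d i))\<^sup>2)) \<le> (\<Sum>i\<in>F. w (g i))"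
    proof (intro sum_mono)
      fix i
      have "exp (- (cmod (d i))\<^sup>2) = exp (- (Re (d i))\<^sup>2) * exp (- (Im (d i))\<^sup>2)"
        by (simp add: cmod_power2 exp_add[symmetric])
      also have "\<dots> \<le> w (g i)"
        unfolding w_def g_def B_def q_def prod.case
        by (intro mult_mono exp_minus_square_le s) auto
      finally show "exp (- (cmod (d i))\<^sup>2) \<le> w (g i)" .
    qed
    also have "\<dots> = sum w (g ` F)" using inj by (simp add: sum.reindex)
    also have "\<dots> \<le> sum w (fst ` g ` F \<times> snd ` g ` F)"
      using F w0 by (intro sum_mono2) (auto simp: image_iff intro!: mem_Times_iff[THEN iffD2] rev_image_eqI)
    also have "\<dots> = (\<Sum>k\<in>fst ` g ` F. B * q ^ nat \<bar>k\<bar>) * (\<Sum>l\<in>snd ` g ` F. B * q ^ nat \<bar>l\<bar>)"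
      unfolding w_def by (simp only: sum_product sum.cartesian_product)
    also have "\<dots> \<le> (B * (2 / (1 - q))) * (B * (2 / (1 - q)))"
      unfolding sum_distrib_left[symmetric]
      using F q by (intro mult_mono mult_left_mono sum_power_abs_int_le) (auto simp: B_def sum_nonneg)
    finally show ?thesis by (simp add: C_def power2_eq_square)
  qed
  have "C > 0" using q by (simp add: C_def B_def)
  then show ?thesis using bound by blast
qed

text \<open>
  If no point is closer to the origin than \<open>\<delta>\<close>, a surplus factor \<open>exp (- r (cmod (d i))\<^sup>2)\<close> is at most
  \<open>exp (- r \<delta>\<^sup>2)\<close>, which beats the constant of the previous lemma when \<open>r\<close> is large.
\<close>

lemma separated_gaussian_sum_small:
  assumes "\<delta> > 0"
  shows "\<exists>c>0. \<forall>(d::'i \<Rightarrow> complex) F. finite F \<longrightarrow> (\<forall>i\<in>F. \<delta> \<le> cmod (d i)) \<longrightarrow>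
    (\<forall>i\<in>F. \<forall>j\<in>F. i \<noteq> j \<longrightarrow> \<delta> \<le> cmod (d i - d j)) \<longrightarrow>
    (\<Sum>i\<in>F. exp (- (c * cmod (d i))\<^sup>2 / 2)) \<le> 1 / 2"
proof -
  obtain C where C: "C > 0"
    "\<forall>(d::'i \<Rightarrow> complex) F. finite F \<longrightarrow> (\<forall>i\<in>F. \<forall>j\<in>F. i \<noteq> j \<longrightarrow> \<delta> \<le> cmod (d i - d j))
      \<longrightarrow> (\<Sum>i\<in>F. exp (- (cmod (d i))\<^sup>2)) \<le> C"
    using separated_gaussian_sum_bounded[OF assms] by blast
  (* Chosen so that exp (- r \<delta>\<^sup>2) \<le> 1 / (2 C). *)
  define r where "r = \<bar>ln (2 * C)\<bar> / \<delta>\<^sup>2"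
  have r: "r \<ge> 0" "exp (- r * \<delta>\<^sup>2) * C \<le> 1 / 2"
  proof -
    have "exp (- r * \<delta>\<^sup>2) \<le> exp (- ln (2 * C))"
      using assms by (simp add: r_def)
    then show "exp (- r * \<delta>\<^sup>2) * C \<le> 1 / 2"
      using C(1) by (simp add: exp_minus field_simps)
  qed (simp add: r_def)
  (* Then c\<^sup>2 / 2 = 1 + r: one unit for the convergence of the sum, the rest for its smallness. *)
  define c where "c = sqrt (2 * (1 + r))"
  have c: "c > 0" "c\<^sup>2 = 2 * (1 + r)" using r by (auto simp: c_def)
  have "(\<Sum>i\<in>F. exp (- (c * cmod (d i))\<^sup>2 / 2)) \<le> 1 / 2"
    if F: "finite F" and far: "\<forall>i\<in>F. \<delta> \<le> cmod (d i)"
      and sep: "\<forall>i\<in>F. \<forall>j\<in>F. i \<noteq> j \<longrightarrow> \<delta> \<le> cmod (d i - d j)"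
    for d :: "'i \<Rightarrow> complex" and F
  proof -
    have "(\<Sum>i\<in>F. exp (- (c * cmod (d i))\<^sup>2 / 2))
        \<le> (\<Sum>i\<in>F. exp (- r * \<delta>\<^sup>2) * exp (- (cmod (d i))\<^sup>2))"
    proof (rule sum_mono)
      fix i assume "i \<in> F"
      then have "r * \<delta>\<^sup>2 \<le> r * (cmod (d i))\<^sup>2"
        using r(1) assms far by (intro mult_left_mono power_mono) auto
      moreover have "- (c * cmod (d i))\<^sup>2 / 2 = - (cmod (d i))\<^sup>2 - r * (cmod (d i))\<^sup>2"
        by (simp add: power_mult_distrib c(2) field_simps)
      ultimately show "exp (- (c * cmod (d i))\<^sup>2 / 2) \<le> exp (- r * \<delta>\<^sup>2) * exp (- (cmod (d i))\<^sup>2)"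
        by (simp add: exp_add[symmetric])
    qed
    also have "\<dots> \<le> exp (- r * \<delta>\<^sup>2) * C"
      unfolding sum_distrib_left[symmetric] using C(2) F sep by (intro mult_left_mono) auto
    finally show ?thesis using r(2) by simp
  qed
  with c(1) show ?thesis by blast
qed

section \<open>Almost orthogonality of the exponentials\<close>

text \<open>
  Apply \<open>2 b n b m \<le> (b n)\<^sup>2 + (b m)\<^sup>2\<close> to every off-diagonal entry; by symmetry of \<open>\<kappa>\<close> the two
  halves have equal sums, and each is controlled by the row sums.
\<close>

lemma schur_test_off_diagonal:
  fixes G :: "'i \<Rightarrow> 'i \<Rightarrow> complex" and \<kappa> :: "'i \<Rightarrow> 'i \<Rightarrow> real" and b :: "'i \<Rightarrow> real"
  assumes F: "finite F" and G: "\<And>n m. n \<in> F \<Longrightarrow> m \<in> F \<Longrightarrow> cmod (G n m) \<le> b n * b m * \<kappa> n m"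
    and sym: "\<And>n m. \<kappa> n m = \<kappa> m n" and nonneg: "\<And>n m. \<kappa> n m \<ge> 0"
    and row: "\<And>n. n \<in> F \<Longrightarrow> (\<Sum>m\<in>F - {n}. \<kappa> n m) \<le> \<theta>"
  shows "cmod ((\<Sum>n\<in>F. \<Sum>m\<in>F. G n m) - (\<Sum>n\<in>F. G n n)) \<le> \<theta> * (\<Sum>n\<in>F. (b n)\<^sup>2)"
proof -
  let ?S = "\<lambda>f. \<Sum>n\<in>F. \<Sum>m\<in>F - {n}. f n m :: real"
  have "(\<Sum>n\<in>F. \<Sum>m\<in>F. G n m) - (\<Sum>n\<in>F. G n n) = (\<Sum>n\<in>F. \<Sum>m\<in>F - {n}. G n m)"
    by (simp add: sum_subtractf[symmetric] sum_diff1 F)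
  also have "cmod \<dots> \<le> ?S (\<lambda>n m. cmod (G n m))"
    by (intro order_trans[OF norm_sum] sum_mono norm_sum)
  also have "\<dots> \<le> ?S (\<lambda>n m. ((b n)\<^sup>2 * \<kappa> n m + (b m)\<^sup>2 * \<kappa> n m) / 2)"
  proof (intro sum_mono)
    fix n m assume nm: "n \<in> F" "m \<in> F - {n}"
    have "2 * (b n * b m) \<le> (b n)\<^sup>2 + (b m)\<^sup>2"
      using sum_squares_bound[of "b n" "b m"] by simp
    from mult_right_mono[OF this nonneg[of n m]] G[of n m] nm
    show "cmod (G n m) \<le> ((b n)\<^sup>2 * \<kappa> n m + (b m)\<^sup>2 * \<kappa> n m) / 2"
      by (simp add: algebra_simps)
  qed
  also have "\<dots> = (?S (\<lambda>n m. (b n)\<^sup>2 * \<kappa> n m) + ?S (\<lambda>n m. (b m)\<^sup>2 * \<kappa> n m)) / 2"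
    by (simp add: sum.distrib sum_divide_distrib[symmetric])
  also have "?S (\<lambda>n m. (b m)\<^sup>2 * \<kappa> n m) = ?S (\<lambda>n m. (b n)\<^sup>2 * \<kappa> n m)"
  proof -
    have "?S (\<lambda>n m. (b m)\<^sup>2 * \<kappa> n m) = (\<Sum>n\<in>F. \<Sum>m\<in>{m\<in>F. n \<noteq> m}. (b m)\<^sup>2 * \<kappa> n m)"
      by (intro sum.cong) auto
    also have "\<dots> = (\<Sum>m\<in>F. \<Sum>n\<in>{n\<in>F. n \<noteq> m}. (b m)\<^sup>2 * \<kappa> n m)"
      by (rule sum.swap_restrict) (use F in auto)
    also have "\<dots> = ?S (\<lambda>n m. (b n)\<^sup>2 * \<kappa> n m)"
      by (intro sum.cong) (auto simp: sym)
    finally show ?thesis .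
  qed
  also have "(?S (\<lambda>n m. (b n)\<^sup>2 * \<kappa> n m) + ?S (\<lambda>n m. (b n)\<^sup>2 * \<kappa> n m)) / 2
      = (\<Sum>n\<in>F. (b n)\<^sup>2 * (\<Sum>m\<in>F - {n}. \<kappa> n m))"
    by (simp add: sum_distrib_left[symmetric])
  also have "\<dots> \<le> (\<Sum>n\<in>F. (b n)\<^sup>2 * \<theta>)"
    by (intro sum_mono mult_left_mono row) auto
  finally show ?thesis
    by (simp add: sum_distrib_left mult.commute)
qed

lemma gaussian_mean_square:
  fixes \<phi> :: "'i \<Rightarrow> 'a::complex_inner" and c :: real
  shows "has_bochner_integral std_normal_distribution
    (\<lambda>s. (norm (\<Sum>n\<in>F. (\<alpha> n * exp (\<mu> n * of_real (c * s))) *\<^sub>C \<phi> n))\<^sup>2)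
    (Re (\<Sum>n\<in>F. \<Sum>m\<in>F. cnj (\<alpha> n) * \<alpha> m * cinner (\<phi> n) (\<phi> m) * exp ((c * (cnj (\<mu> n) + \<mu> m))\<^sup>2 / 2)))"
proof -
  have "(norm (\<Sum>n\<in>F. (\<alpha> n * exp (\<mu> n * of_real (c * s))) *\<^sub>C \<phi> n))\<^sup>2
    = Re (\<Sum>n\<in>F. \<Sum>m\<in>F. cnj (\<alpha> n) * \<alpha> m * cinner (\<phi> n) (\<phi> m) * exp ((c * (cnj (\<mu> n) + \<mu> m)) * of_real s))"
    (is "(norm ?x)\<^sup>2 = _") for s
  proof -
    have exp_eq: "exp ((c * (cnj (\<mu> n) + \<mu> m)) * of_real s)
        = cnj (exp (\<mu> n * of_real (c * s))) * exp (\<mu> m * of_real (c * s))" for n m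
      by (simp add: exp_cnj exp_add[symmetric] algebra_simps)
    have "cinner ?x ?x = (\<Sum>n\<in>F. \<Sum>m\<in>F. cnj (\<alpha> n * exp (\<mu> n * of_real (c * s)))
        * (\<alpha> m * exp (\<mu> m * of_real (c * s)) * cinner (\<phi> n) (\<phi> m)))"
      unfolding cinner_sum_left by (simp only: cinner_sum_right cinner_scaleC_left
          cinner_scaleC_right mult.left_commute)
    also have "\<dots> = (\<Sum>n\<in>F. \<Sum>m\<in>F. cnj (\<alpha> n) * \<alpha> m * cinner (\<phi> n) (\<phi> m)
        * exp ((c * (cnj (\<mu> n) + \<mu> m)) * of_real s))"
      by (intro sum.cong refl) (simp only: exp_eq complex_cnj_mult, simp only: mult_ac)
    finally have expansion: "cinner ?x ?x = \<dots>" .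
    show ?thesis
      unfolding expansion[symmetric] by (simp only: cinner_self Re_complex_of_real)
  qed
  moreover have "has_bochner_integral std_normal_distribution
    (\<lambda>s. Re (\<Sum>n\<in>F. \<Sum>m\<in>F. cnj (\<alpha> n) * \<alpha> m * cinner (\<phi> n) (\<phi> m) * exp ((c * (cnj (\<mu> n) + \<mu> m)) * of_real s)))
    (Re (\<Sum>n\<in>F. \<Sum>m\<in>F. cnj (\<alpha> n) * \<alpha> m * cinner (\<phi> n) (\<phi> m) * exp ((c * (cnj (\<mu> n) + \<mu> m))\<^sup>2 / 2)))"
    by (intro has_bochner_integral_Re has_bochner_integral_sum has_bochner_integral_mult_right
        has_bochner_integral_std_normal_exp)
  ultimately show ?thesis by (simp only:)
qed

text \<open>
  The factors \<open>cinner (\<phi> n) (\<phi> m)\<close> have modulus at most \<open>1\<close>, with equality to \<open>1\<close> on the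
  diagonal, so the smallness of the cross terms comes from the decay of the Gaussian moments.
\<close>

lemma gaussian_mean_square_bounds:
  fixes \<phi> :: "'i \<Rightarrow> 'a::complex_inner" and \<mu> \<alpha> :: "'i \<Rightarrow> complex"
  assumes F: "finite F" and unit: "\<And>n. norm (\<phi> n) = 1"
    and row: "\<And>n. n \<in> F \<Longrightarrow> (\<Sum>m\<in>F - {n}. exp (- (c * cmod (\<mu> n - \<mu> m))\<^sup>2 / 2)) \<le> 1 / 2"
  defines "Q \<equiv> \<Sum>n\<in>F. (cmod (\<alpha> n) * exp ((c * Re (\<mu> n))\<^sup>2))\<^sup>2"
  obtains I where "has_bochner_integral std_normal_distribution
      (\<lambda>s. (norm (\<Sum>n\<in>F. (\<alpha> n * exp (\<mu> n * of_real (c * s))) *\<^sub>C \<phi> n))\<^sup>2) I"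
    "Q / 2 \<le> I" "I \<le> 3 / 2 * Q"
proof -
  define b where "b n = cmod (\<alpha> n) * exp ((c * Re (\<mu> n))\<^sup>2)" for n
  define G where "G n m = cnj (\<alpha> n) * \<alpha> m * cinner (\<phi> n) (\<phi> m) * exp ((c * (cnj (\<mu> n) + \<mu> m))\<^sup>2 / 2)" for n m
  have diag: "G n n = of_real ((b n)\<^sup>2)" for n
  proof -
    have "(c * (cnj (\<mu> n) + \<mu> n))\<^sup>2 / 2 = of_real (2 * (c * Re (\<mu> n))\<^sup>2)"
      by (simp add: complex_eq_iff power2_eq_square algebra_simps)
    then have "exp ((c * (cnj (\<mu> n) + \<mu> n))\<^sup>2 / 2) = of_real ((exp ((c * Re (\<mu> n))\<^sup>2))\<^sup>2)"
      by (simp only: exp_of_real exp_double)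
    moreover have "cnj (\<alpha> n) * \<alpha> n = of_real ((cmod (\<alpha> n))\<^sup>2)"
      by (simp only: complex_norm_square mult.commute)
    ultimately show ?thesis
      by (simp add: G_def b_def cinner_self unit power_mult_distrib)
  qed
  have "cmod (G n m) \<le> b n * b m * exp (- (c * cmod (\<mu> n - \<mu> m))\<^sup>2 / 2)" for n m
  proof -
    have "cmod (G n m) = cmod (cinner (\<phi> n) (\<phi> m)) * (b n * b m * exp (- (c * cmod (\<mu> n - \<mu> m))\<^sup>2 / 2))"
      unfolding G_def b_def norm_mult gaussian_gram_entry complex_mod_cnj by (simp only: mult_ac)
    also have "\<dots> \<le> 1 * (b n * b m * exp (- (c * cmod (\<mu> n - \<mu> m))\<^sup>2 / 2))"
      using cmod_cinner_le[of "\<phi> n" "\<phi> m"] by (intro mult_right_mono) (auto simp: unit b_def)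
    finally show ?thesis by simp
  qed
  then have "cmod ((\<Sum>n\<in>F. \<Sum>m\<in>F. G n m) - (\<Sum>n\<in>F. G n n)) \<le> 1 / 2 * (\<Sum>n\<in>F. (b n)\<^sup>2)"
    using F row by (intro schur_test_off_diagonal[where
          \<kappa> = "\<lambda>n m. exp (- (c * cmod (\<mu> n - \<mu> m))\<^sup>2 / 2)"]) (auto simp: norm_minus_commute)
  moreover have "(\<Sum>n\<in>F. G n n) = of_real Q"
    by (simp add: diag Q_def b_def)
  ultimately have "\<bar>Re (\<Sum>n\<in>F. \<Sum>m\<in>F. G n m) - Q\<bar> \<le> 1 / 2 * Q"
    using abs_Re_le_cmod[of "(\<Sum>n\<in>F. \<Sum>m\<in>F. G n m) - (\<Sum>n\<in>F. G n n)"]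
    by (simp add: Q_def b_def)
  then have Q: "Q / 2 \<le> Re (\<Sum>n\<in>F. \<Sum>m\<in>F. G n m)" "Re (\<Sum>n\<in>F. \<Sum>m\<in>F. G n m) \<le> 3 / 2 * Q"
    by linarith+
  have "has_bochner_integral std_normal_distribution
      (\<lambda>s. (norm (\<Sum>n\<in>F. (\<alpha> n * exp (\<mu> n * of_real (c * s))) *\<^sub>C \<phi> n))\<^sup>2)
      (Re (\<Sum>n\<in>F. \<Sum>m\<in>F. G n m))"
    unfolding G_def by (rule gaussian_mean_square)
  then show ?thesis
    using Q by (rule that)
qed

section \<open>The Riesz basis property\<close>

text \<open>
  The growth bound for \<open>T (c s)\<close> gives the upper estimate, and the same bound for its inverse
  \<open>T (- (c s))\<close> the lower one. The modulus in the exponent is removed by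
  \<open>exp (v \<bar>s\<bar>) \<le> exp (v s) + exp (- v s)\<close>, whose mean is explicit; for the lower estimate it
  suffices that the reciprocal of the right-hand side has a positive mean.
\<close>

lemma C0_group_gaussian_mean_equivalent:
  fixes T :: "real \<Rightarrow> 'a \<Rightarrow> 'a::chilbert_space"
  assumes T: "C0_group T"
  obtains a b where "a > 0" "b > 0"
    "\<And>x I. has_bochner_integral std_normal_distribution (\<lambda>s. (norm (T (c * s) x))\<^sup>2) I
      \<Longrightarrow> a * (norm x)\<^sup>2 \<le> I \<and> I \<le> b * (norm x)\<^sup>2"
proof -
  obtain K w where K: "K \<ge> 1" and grow: "\<And>t x. norm (T t x) \<le> K * exp (w * \<bar>t\<bar>) * norm x"
    using C0_group_growth[OF T] by metis
  define v where "v = 2 * w * \<bar>c\<bar>"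
  have sq: "(norm (T t x))\<^sup>2 \<le> K\<^sup>2 * exp (2 * w * \<bar>t\<bar>) * (norm x)\<^sup>2" for t x
    using power_mono[OF grow[of t x], of 2]
    by (simp add: power_mult_distrib exp_double[symmetric] mult.assoc)
  define p where "p s = exp (v * s) + exp (- v * s)" for s
  have p: "has_bochner_integral std_normal_distribution p (2 * exp (v\<^sup>2 / 2))"
    unfolding p_def using has_bochner_integral_add[OF has_bochner_integral_std_normal_exp_real
        has_bochner_integral_std_normal_exp_real, of v "- v"] by simp
  have le_p: "exp (2 * w * \<bar>c * s\<bar>) \<le> p s" for s
    by (simp add: p_def v_def abs_mult abs_if mult_ac)
  have p_pos: "p s > 0" for s by (simp add: p_def add_pos_pos)
  interpret prob_space std_normal_distribution
    using prob_space_normal_density[of 1 0] by simp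
  have mono: "I \<le> J" if "has_bochner_integral std_normal_distribution f I"
    "has_bochner_integral std_normal_distribution g J" "\<And>s. f s \<le> g s" for f g and I J :: real
    using that by (auto simp: has_bochner_integral_iff intro: integral_mono)
  define e where "e = expectation (\<lambda>s. 1 / p s)"
  have int_e: "integrable std_normal_distribution (\<lambda>s. 1 / p s)"
  proof (rule integrable_const_bound[of _ 1])
    have "p s \<ge> 1" for s
    proof -
      have "exp (v * s) \<ge> 1 \<or> exp (- v * s) \<ge> 1" by (cases "v * s \<ge> 0") auto
      then show ?thesis unfolding p_def by (smt (verit) exp_gt_zero)
    qed
    then show "AE s in std_normal_distribution. norm (1 / p s) \<le> 1"
      using p_pos by (intro AE_I2) (simp add: abs_of_pos)
  qed (simp add: p_def)
  have "e > 0"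
    unfolding e_def using p_pos by (intro expectation_greater int_e) auto
  moreover have "e / K\<^sup>2 * (norm x)\<^sup>2 \<le> I \<and> I \<le> K\<^sup>2 * (2 * exp (v\<^sup>2 / 2)) * (norm x)\<^sup>2"
    if I: "has_bochner_integral std_normal_distribution (\<lambda>s. (norm (T (c * s) x))\<^sup>2) I" for x I
  proof
    have "(norm (T (c * s) x))\<^sup>2 \<le> K\<^sup>2 * p s * (norm x)\<^sup>2" for s
      by (rule order_trans[OF sq]) (intro mult_right_mono mult_left_mono le_p, auto)
    then show "I \<le> K\<^sup>2 * (2 * exp (v\<^sup>2 / 2)) * (norm x)\<^sup>2"
      by (rule mono[OF I has_bochner_integral_mult_left[OF has_bochner_integral_mult_right[OF p]]])
    have "1 / p s * ((norm x)\<^sup>2 / K\<^sup>2) \<le> (norm (T (c * s) x))\<^sup>2" for s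
    proof -
      have "T (- (c * s)) (T (c * s) x) = x"
        using T unfolding C0_group_def by (metis add.left_inverse)
      then have "(norm x)\<^sup>2 \<le> K\<^sup>2 * exp (2 * w * \<bar>c * s\<bar>) * (norm (T (c * s) x))\<^sup>2"
        using sq[of "- (c * s)" "T (c * s) x"] by simp
      also have "\<dots> \<le> K\<^sup>2 * p s * (norm (T (c * s) x))\<^sup>2"
        by (intro mult_right_mono mult_left_mono le_p) auto
      finally show ?thesis
        using p_pos[of s] K by (simp add: field_simps)
    qed
    from mono[OF has_bochner_integral_mult_left[OF has_bochner_integral_integrable[OF int_e]] I this]
    show "e / K\<^sup>2 * (norm x)\<^sup>2 \<le> I"
      by (simp add: e_def)
  qed
  ultimately show ?thesis
    using that[of "e / K\<^sup>2" "K\<^sup>2 * (2 * exp (v\<^sup>2 / 2))"] K by simp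
qed

text \<open>
  Compare the orbit with the growth bound at the times \<open>1\<close> and \<open>- 1\<close>.
\<close>

lemma C0_group_eigenvalues_in_strip:
  assumes T: "C0_group T"
  obtains R where "\<And>\<mu> x. x \<noteq> 0 \<Longrightarrow> (\<And>t. T t x = exp (\<mu> * of_real t) *\<^sub>C x) \<Longrightarrow> \<bar>Re \<mu>\<bar> \<le> R"
proof -
  obtain K w where K: "K \<ge> 1" and grow: "\<And>t x. norm (T t x) \<le> K * exp (w * \<bar>t\<bar>) * norm x"
    using C0_group_growth[OF T] by metis
  have "\<bar>Re \<mu>\<bar> \<le> ln K + w" if x: "x \<noteq> 0" and orbit: "\<And>t. T t x = exp (\<mu> * of_real t) *\<^sub>C x" for \<mu> x
  proof -
    have "Re \<mu> * t \<le> ln K + w" if t: "\<bar>t\<bar> = 1" for t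
    proof -
      have "exp (Re \<mu> * t) * norm x \<le> exp (ln K + w) * norm x"
        using grow[of t x] K t by (simp add: orbit norm_scaleC norm_exp_eq_Re exp_add)
      then show ?thesis using x by simp
    qed
    from this[of 1] this[of "- 1"] show ?thesis by simp
  qed
  then show ?thesis using that by blast
qed

theorem theorem1p1:
  fixes T :: "real \<Rightarrow> 'a \<Rightarrow> 'a::chilbert_space"
    and D :: "'a set"
    and A :: "'a \<Rightarrow> 'a"
    and lam :: "nat \<Rightarrow> complex"
    and \<phi> :: "nat \<Rightarrow> 'a"
  assumes "C0_group T"
    and "is_generator T D A"
    and "eigen_enumeration D A lam \<phi>"
    and "closure (complex_vector.span (range \<phi>)) = UNIV"
    and "(INF p\<in>{(n, m). n \<noteq> m}. cmod (lam (fst p) - lam (snd p))) > 0"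
  shows "riesz_basis \<phi>"
proof -
  define \<delta> where "\<delta> = (INF p\<in>{(n::nat, m). n \<noteq> m}. cmod (lam (fst p) - lam (snd p)))"
  have \<delta>: "\<delta> > 0" using assms(5) by (simp add: \<delta>_def)
  have sep: "\<delta> \<le> cmod (lam n - lam m)" if "n \<noteq> m" for n m
    unfolding \<delta>_def using that
    by (intro cINF_lower2[where x = "(n, m)"] bdd_belowI[of _ 0]) auto
  have unit: "norm (\<phi> n) = 1" for n
    using assms(3) by (simp add: eigen_enumeration_def)
  have orbit: "T t (\<phi> n) = exp (lam n * of_real t) *\<^sub>C \<phi> n" for t n
    using assms(3) by (intro C0_group_eigenvector[OF assms(1,2)]) (simp add: eigen_enumeration_def)
  obtain R where R: "\<And>n. \<bar>Re (lam n)\<bar> \<le> R"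
    using C0_group_eigenvalues_in_strip[OF assms(1)] orbit unit by (metis norm_zero zero_neq_one)
  obtain c where c: "c > 0" and small: "\<forall>(d::nat \<Rightarrow> complex) F. finite F \<longrightarrow>
      (\<forall>i\<in>F. \<delta> \<le> cmod (d i)) \<longrightarrow> (\<forall>i\<in>F. \<forall>j\<in>F. i \<noteq> j \<longrightarrow> \<delta> \<le> cmod (d i - d j)) \<longrightarrow>
      (\<Sum>i\<in>F. exp (- (c * cmod (d i))\<^sup>2 / 2)) \<le> 1 / 2"
    using separated_gaussian_sum_small[OF \<delta>] by blast
  have row: "(\<Sum>m\<in>{..<N} - {n}. exp (- (c * cmod (lam n - lam m))\<^sup>2 / 2)) \<le> 1 / 2" for n N
    by (rule small[rule_format]) (auto intro: sep)
  obtain a b where ab: "a > 0" "b > 0" and equiv: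
    "\<And>x I. has_bochner_integral std_normal_distribution (\<lambda>s. (norm (T (c * s) x))\<^sup>2) I
      \<Longrightarrow> a * (norm x)\<^sup>2 \<le> I \<and> I \<le> b * (norm x)\<^sup>2"
    using C0_group_gaussian_mean_equivalent[OF assms(1), of c] by metis
  define E where "E = exp (2 * (c * R)\<^sup>2)"
  have bounds: "1 / (2 * b) * (\<Sum>n<N. (cmod (\<alpha> n))\<^sup>2) \<le> (norm (\<Sum>n<N. \<alpha> n *\<^sub>C \<phi> n))\<^sup>2 \<and>
      (norm (\<Sum>n<N. \<alpha> n *\<^sub>C \<phi> n))\<^sup>2 \<le> (3 * E / (2 * a)) * (\<Sum>n<N. (cmod (\<alpha> n))\<^sup>2)"
    for N and \<alpha> :: "nat \<Rightarrow> complex"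
  proof -
    define x where "x = (\<Sum>n<N. \<alpha> n *\<^sub>C \<phi> n)"
    define S where "S = (\<Sum>n<N. (cmod (\<alpha> n))\<^sup>2)"
    define Q where "Q = (\<Sum>n<N. (cmod (\<alpha> n) * exp ((c * Re (lam n))\<^sup>2))\<^sup>2)"
    have Tx: "T t x = (\<Sum>n<N. (\<alpha> n * exp (lam n * of_real t)) *\<^sub>C \<phi> n)" for t
    proof -
      have lin: "bounded_linear (T t)" "\<And>k y. T t (k *\<^sub>C y) = k *\<^sub>C T t y"
        using assms(1) by (auto simp: C0_group_def bounded_clinear_def)
      show ?thesis
        by (simp add: x_def linear_sum[OF bounded_linear.linear[OF lin(1)]] lin(2) orbit scaleC_scaleC)
    qed
    obtain I where "has_bochner_integral std_normal_distribution (\<lambda>s. (norm (T (c * s) x))\<^sup>2) I"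
        and Q: "Q / 2 \<le> I" "I \<le> 3 / 2 * Q"
      using gaussian_mean_square_bounds[of "{..<N}" \<phi> c lam \<alpha>] row unit
      unfolding Tx Q_def by blast
    then have x: "a * (norm x)\<^sup>2 \<le> I" "I \<le> b * (norm x)\<^sup>2"
      using equiv by auto
    have "S \<le> Q"
      unfolding S_def Q_def by (intro sum_mono power_mono) (auto intro: mult_le_cancel_left1[THEN iffD2])
    have "Q \<le> E * S"
    proof -
      have "(c * Re (lam n))\<^sup>2 \<le> (c * R)\<^sup>2" for n
        using R[of n] c by (intro abs_le_square_iff[THEN iffD1]) (simp add: abs_mult mult_left_mono)
      then have "(exp ((c * Re (lam n))\<^sup>2))\<^sup>2 \<le> E" for n
        unfolding E_def exp_double by (intro power_mono) auto
      then show ?thesis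
        unfolding Q_def S_def sum_distrib_left
        by (intro sum_mono) (subst power_mult_distrib, subst mult.commute, intro mult_right_mono, auto)
    qed
    have "S \<le> 2 * b * (norm x)\<^sup>2"
      using \<open>S \<le> Q\<close> Q(1) x(2) by linarith
    moreover have "2 * a * (norm x)\<^sup>2 \<le> 3 * E * S"
      using \<open>Q \<le> E * S\<close> Q(2) x(1) by linarith
    ultimately show ?thesis
      unfolding x_def[symmetric] S_def[symmetric] using ab by (simp add: field_simps)
  qed
  show ?thesis
    unfolding riesz_basis_def
  proof (intro conjI exI allI)
    show "closure (complex_vector.span (range \<phi>)) = UNIV" by (rule assms(4))
    show "1 / (2 * b) > 0" "3 * E / (2 * a) > 0" using ab by (auto simp: E_def)
  qed (use bounds in auto)
qed

end
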